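(* Let $A$ be an $n\times n$ matrix with complex entries whose distinct eigenvalues are $\lambda_1,\lambda_2,\dots,\lambda_k$, of algebraic multiplicities $r_1,r_2,\dots,r_k$ respectively, and let $I$ be the $n\times n$ identity matrix. Then the following hold. (i) There exists a unique partial fraction decomposition of the resolvent of $A$, i.e. there is a unique family of complex $n\times n$ matrices $B_{ij}$ ($1\le i\le k$, $1\le j\le r_i$) such that $$(sI-A)^{-1}=\sum_{i=1}^k\sum_{j=1}^{r_i}\frac{1}{(s-\lambda_i)^j}B_{ij}$$ for all $s\in\mathbb{C}\setminus\{\lambda_1,\dots,\lambda_k\}$. With $B_{ij}$ denoting these matrices, for every $i\in\{1,\dots,k\}$: (ii) If $b$ is a nonzero column of the matrix $B_{ir_i}$, then $b$ is an eigenvector of $A$ corresponding to the eigenvalue $\lambda_i$. (iii) If $1\le j\le r_i$ and $b$ is a nonzero column of the matrix $B_{ij}$, then $b$ is a generalized eigenvector of $A$ corresponding to the eigenvalue $\lambda_i$, of rank less than or equal to $r_i+1-j$. (iv) For every $m=1,\dots,n$, the nonzero vectors among the $m$th columns of the matrices $B_{i1},B_{i2},\dots,B_{ir_i}$, listed in order of increasing $j$, form a chain of generalized eigenvectors of $A$ corresponding to $\lambda_i$ ending with an eigenvector. (v) If $v$ is a generalized eigenvector of $A$ corresponding to $\lambda_i$, then $v$ belongs to the column space of each of the matrices $B_{i1},B_{i2},\dots,B_{ij_0}$, where $$j_0=1+\max\{m\in\mathbb{Z}_{\ge 0} \mid v\in \operatorname{Image}((A-\lambda_iI)^m)\}.$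$
   Context: The algebraic multiplicities are those in the characteristic polynomial: $\det(sI-A)=(s-\lambda_1)^{r_1}(s-\lambda_2)^{r_2}\cdots(s-\lambda_k)^{r_k}$ with $\lambda_1,\dots,\lambda_k$ distinct and $r_1+\dots+r_k=n$. A nonzero vector $v\in\mathbb{C}^n$ is a generalized eigenvector of $A$ corresponding to the eigenvalue $\lambda$ if $(A-\lambda I)^p v=0$ for some integer $p\ge 1$; its rank is the least such $p$, so that eigenvectors are exactly the generalized eigenvectors of rank $1$. A chain of generalized eigenvectors of $A$ corresponding to $\lambda$ ending with an eigenvector is a list of nonzero vectors $v_1,v_2,\dots,v_l$ such that $(A-\lambda I)v_j=v_{j+1}$ for $j=1,\dots,l-1$ and $(A-\lambda I)v_l=0$; thus $v_j$ has rank $l-j+1$. If there are no nonzero vectors among those considered (the list is empty), the assertion that they form a chain is vacuous. The matrix power $(A-\lambda_i I)^0$ is the identity matrix, and $\operatorname{Image}(C)$ denotes the image of $\mathbb{C}^n$ under the matrix $C$. *)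

theory Defs
  imports
    "Jordan_Normal_Form.Char_Poly"
    "Jordan_Normal_Form.VS_Connect"
    "Jordan_Normal_Form.Gauss_Jordan_Elimination"
begin

text \<open>\<^const>\<open>char_matrix\<close> \<open>A e\<close> is the matrix \<open>A - e I\<close>.\<close>

definition generalized_eigenvector :: "complex mat \<Rightarrow> complex vec \<Rightarrow> complex \<Rightarrow> bool" where
  "generalized_eigenvector A v e \<longleftrightarrow>
     v \<in> carrier_vec (dim_row A) \<and> v \<noteq> 0\<^sub>v (dim_row A) \<and>
     (\<exists>p\<ge>1. (char_matrix A e ^\<^sub>m p) *\<^sub>v v = 0\<^sub>v (dim_row A))"

text \<open>Only meaningful when \<open>generalized_eigenvector A v e\<close> holds.\<close>

definition gen_eigvec_rank :: "complex mat \<Rightarrow> complex vec \<Rightarrow> complex \<Rightarrow> nat" where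
  "gen_eigvec_rank A v e =
     (LEAST p. p \<ge> 1 \<and> (char_matrix A e ^\<^sub>m p) *\<^sub>v v = 0\<^sub>v (dim_row A))"

text \<open>The empty list counts as a chain.\<close>

definition gen_eigvec_chain :: "complex mat \<Rightarrow> complex \<Rightarrow> complex vec list \<Rightarrow> bool" where
  "gen_eigvec_chain A e vs \<longleftrightarrow>
     (\<forall>v\<in>set vs. v \<in> carrier_vec (dim_row A) \<and> v \<noteq> 0\<^sub>v (dim_row A)) \<and>
     (\<forall>j. Suc j < length vs \<longrightarrow> char_matrix A e *\<^sub>v (vs ! j) = vs ! Suc j) \<and>
     (vs \<noteq> [] \<longrightarrow> char_matrix A e *\<^sub>v last vs = 0\<^sub>v (dim_row A))"

definition mat_image :: "complex mat \<Rightarrow> complex vec set" where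
  "mat_image C = (\<lambda>w. C *\<^sub>v w) ` carrier_vec (dim_col C)"

text \<open>
  \<open>B (i, j)\<close> is the coefficient of \<open>1 / (s - lam i) ^ j\<close>. Families are taken extensional, i.e.
  \<^const>\<open>undefined\<close> outside the index set, so that uniqueness of the family is uniqueness of
  the function \<open>B\<close>. The equation \<open>mat_inverse M = Some X\<close> says that \<open>M\<close> is
  invertible with inverse \<open>X\<close>.
\<close>

definition resolvent_pfd ::
  "nat \<Rightarrow> complex mat \<Rightarrow> nat \<Rightarrow> (nat \<Rightarrow> complex) \<Rightarrow> (nat \<Rightarrow> nat) \<Rightarrow>
     (nat \<times> nat \<Rightarrow> complex mat) \<Rightarrow> bool" where
  "resolvent_pfd n A k lam r B \<longleftrightarrow>
     B \<in> (SIGMA i:{1..k}. {1..r i}) \<rightarrow>\<^sub>E carrier_mat n n \<and>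
     (\<forall>s. s \<notin> lam ` {1..k} \<longrightarrow>
        mat_inverse (s \<cdot>\<^sub>m 1\<^sub>m n - A) =
          Some (\<Oplus>\<^bsub>module_mat TYPE(complex) n n\<^esub>i\<in>{1..k}.
                  \<Oplus>\<^bsub>module_mat TYPE(complex) n n\<^esub>j\<in>{1..r i}.
                    (1 / (s - lam i) ^ j) \<cdot>\<^sub>m B (i, j)))"

end

theory Submission
  imports Defs "HOL-Computational_Algebra.Fundamental_Theorem_Algebra"
begin

text \<open>
  Two scalar facts carry everything: a proper rational function whose denominator is a product of
  powers of distinct linear factors has a partial fraction expansion
  (\<open>partial_fractions_exist\<close>), and the functions \<open>1\<close> and \<open>1 / (s - lam i) ^ j\<close> are linearly
  independent on the complement of the poles (\<open>partial_fractions_unique\<close>).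

  Cramer's rule writes the resolvent as the adjugate of \<open>s I - A\<close> over the characteristic
  polynomial. The entries of the adjugate are minors of size \<open>n - 1\<close>, hence polynomials in \<open>s\<close> of
  degree below \<open>n\<close>, so every entry of the resolvent is proper and can be expanded. Existence and
  uniqueness of the family \<open>B\<close> follow entry by entry.

  Everything else comes from comparing coefficients. Write \<open>R s\<close> for the resolvent and \<open>N i\<close> for
  \<open>A - lam i I\<close>, so that \<open>s I - A = (s - lam i) I - N i\<close> for every \<open>i\<close>. Expanding
  \<open>(s I - A) R s = I\<close> in this way, the coefficient of \<open>1 / (s - lam i) ^ j\<close> is
  \<open>B (i, j + 1) - N i B (i, j)\<close>, where the term \<open>B (i, r i + 1)\<close> is read as zero; so it must vanish
  (\<open>char_matrix_mult_col\<close>). Thus \<open>N i\<close> shifts each column of \<open>B (i, j)\<close> to the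
  same column of \<open>B (i, j + 1)\<close> and kills those of \<open>B (i, r i)\<close>, which gives the eigenvectors, the
  bound on the ranks, and the chains.

  Conversely, if \<open>N i ^ p\<close> kills \<open>v\<close>, then the sum of \<open>N i ^ (j - 1) v / (s - lam i) ^ j\<close> over
  \<open>1 \<le> j \<le> p\<close> is mapped to \<open>v\<close> by \<open>s I - A\<close>, by telescoping, and so it equals \<open>R s v\<close>. Comparing
  this with the expansion of \<open>R s\<close> gives \<open>B (i, j) v = N i ^ (j - 1) v\<close> and \<open>N i ^ r i v = 0\<close>
  (\<open>coefficients_mult_gen_eigenvector\<close>). Now let \<open>v = N i ^ m w\<close> be a generalized eigenvector. Then
  so are \<open>w\<close> and its nonzero images under powers of \<open>N i\<close>. Since \<open>v\<close> is nonzero,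
  \<open>m < r i\<close>; and for \<open>j \<le> m + 1\<close> the vector \<open>v\<close> is \<open>N i ^ (j - 1)\<close>
  applied to \<open>N i ^ (m + 1 - j) w\<close>, hence \<open>B (i, j)\<close> applied to that vector.
\<close>

section \<open>Partial fractions of scalar rational functions\<close>

text \<open>The most singular term at a pole is isolated by a limit: if \<open>J\<close> is the largest index with
  \<open>c i J \<noteq> 0\<close>, then multiplying the identity by \<open>(s - lam i) ^ J\<close> and letting \<open>s\<close> tend to \<open>lam i\<close>
  leaves \<open>c i J = 0\<close>. The constant \<open>d\<close> is there because the products expanded below have a
  polynomial part of degree zero.\<close>

lemma partial_fractions_unique:
  fixes c :: "'a \<Rightarrow> nat \<Rightarrow> complex" and lam :: "'a \<Rightarrow> complex"
  assumes I: "finite I" and inj: "inj_on lam I"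
    and eq: "\<And>s. s \<notin> lam ` I \<Longrightarrow> (\<Sum>i\<in>I. \<Sum>j=1..r i. c i j / (s - lam i) ^ j) = d"
    and i: "i \<in> I" and j: "j \<in> {1..r i}"
  shows "c i j = 0"
proof (rule ccontr)
  assume nz: "c i j \<noteq> 0"
  define S where "S = {j \<in> {1..r i}. c i j \<noteq> 0}"
  define J where "J = Max S"
  have S: "finite S" "S \<noteq> {}" using nz j by (auto simp: S_def)
  have JS: "J \<in> S" unfolding J_def by (rule Max_in[OF S])
  have Jmax: "c i l = 0" if "l \<in> {1..r i}" "l > J" for l
  proof (rule ccontr)
    assume "c i l \<noteq> 0"
    hence "l \<in> S" using that by (simp add: S_def)
    thus False using Max_ge[OF S(1), of l] that by (simp add: J_def)
  qed
  \<comment> \<open>\<open>G\<close> is the part that stays bounded near \<open>lam i\<close>; \<open>H\<close> is the principal part there times \<open>(s - lam i) ^ J\<close>.\<close>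
  define G where "G s = (\<Sum>l\<in>I-{i}. \<Sum>j=1..r l. c l j / (s - lam l) ^ j) - d" for s
  define H where "H s = (\<Sum>j=1..J. c i j * (s - lam i) ^ (J - j))" for s
  have ev: "\<forall>\<^sub>F s in at (lam i). H s + (s - lam i) ^ J * G s = 0"
    unfolding eventually_at_topological
  proof (intro exI[of _ "- (lam ` I - {lam i})"] conjI ballI impI)
    show "open (- (lam ` I - {lam i}))"
      using I by (intro open_Compl finite_imp_closed) auto
    fix s assume s: "s \<in> - (lam ` I - {lam i})" "s \<noteq> lam i"
    hence "s \<notin> lam ` I" by auto
    note E = eq[OF this]
    have "(\<Sum>i\<in>I. \<Sum>j=1..r i. c i j / (s - lam i) ^ j) =
       (\<Sum>j=1..r i. c i j / (s - lam i) ^ j) + (\<Sum>l\<in>I-{i}. \<Sum>j=1..r l. c l j / (s - lam l) ^ j)"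
      by (rule sum.remove[OF I i])
    hence E': "(\<Sum>j=1..r i. c i j / (s - lam i) ^ j) + G s = 0"
      using E unfolding G_def by (simp only: add_diff_eq diff_self)
    have "(\<Sum>j=1..r i. c i j / (s - lam i) ^ j) = (\<Sum>j=1..J. c i j / (s - lam i) ^ j)"
      by (rule sum.mono_neutral_right) (use JS Jmax in \<open>auto simp: S_def\<close>)
    moreover have "(s - lam i) ^ J * (\<Sum>j=1..J. c i j / (s - lam i) ^ j) = H s"
      unfolding H_def sum_distrib_left using s(2) by (intro sum.cong) (auto simp: power_diff)
    ultimately have "H s + (s - lam i) ^ J * G s =
        (s - lam i) ^ J * ((\<Sum>j=1..r i. c i j / (s - lam i) ^ j) + G s)"
      by (simp add: ring_distribs)
    thus "H s + (s - lam i) ^ J * G s = 0" by (simp only: E' mult_zero_right)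
  qed auto
  have "(G \<longlongrightarrow> G (lam i)) (at (lam i))"
    unfolding G_def using i by (intro tendsto_intros) (auto dest: inj_onD[OF inj])
  moreover have "(H \<longlongrightarrow> H (lam i)) (at (lam i))"
    unfolding H_def by (intro tendsto_intros)
  moreover have "((\<lambda>s. (s - lam i) ^ J) \<longlongrightarrow> (lam i - lam i) ^ J) (at (lam i))"
    by (intro tendsto_intros)
  ultimately have "((\<lambda>s. H s + (s - lam i) ^ J * G s) \<longlongrightarrow> 
     H (lam i) + (lam i - lam i) ^ J * G (lam i)) (at (lam i))"
    by (intro tendsto_intros)
  hence "((\<lambda>s. 0) \<longlongrightarrow> H (lam i) + (lam i - lam i) ^ J * G (lam i)) (at (lam i))"
    by (rule Lim_transform_eventually) (rule ev)
  hence "H (lam i) + (lam i - lam i) ^ J * G (lam i) = 0"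
    by (simp add: tendsto_const_iff)
  moreover have "H (lam i) = (\<Sum>j=1..J. if j = J then c i J else 0)"
    unfolding H_def by (rule sum.cong) (auto simp: power_0_left)
  ultimately show False using JS by (simp add: S_def power_0_left)
qed

text \<open>Poles are removed one order at a time. At a pole \<open>lam i\<close> of order \<open>r i\<close> let \<open>q\<close> be the product
  of the other factors; subtracting \<open>c0 / (s - lam i) ^ r i\<close> with \<open>c0 = p (lam i) / q (lam i)\<close>
  makes the numerator divisible by \<open>s - lam i\<close>, so both the total order and the degree bound drop
  by one. The alternative \<open>p = 0\<close> covers total order zero, where no degree is small enough.\<close>

lemma partial_fractions_exist:
  fixes p :: "complex poly" and lam :: "'a \<Rightarrow> complex"
  assumes I: "finite I" and inj: "inj_on lam I"
    and deg: "p = 0 \<or> degree p < sum r I"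
  shows "\<exists>c. \<forall>s. s \<notin> lam ` I \<longrightarrow>
    poly p s / (\<Prod>i\<in>I. (s - lam i) ^ r i) = (\<Sum>i\<in>I. \<Sum>j=1..r i. c i j / (s - lam i) ^ j)"
  using deg
proof (induction "sum r I" arbitrary: r p)
  case 0
  hence "p = 0" by simp
  thus ?case by (intro exI[of _ "\<lambda>i j. 0"]) simp
next
  case (Suc N)
  from Suc.hyps(2) obtain i where i: "i \<in> I" "r i > 0"
    by (metis I Zero_not_Suc gr0I sum.neutral)
  define q where "q = (\<Prod>l\<in>I-{i}. [:- lam l, 1:] ^ r l)"
  define r' where "r' = r(i := r i - 1)"
  have nz: "poly q (lam i) \<noteq> 0"
    using I inj i by (auto simp: q_def poly_prod prod_zero_iff inj_on_eq_iff)
  define c0 where "c0 = poly p (lam i) / poly q (lam i)"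
  have "poly (p - Polynomial.smult c0 q) (lam i) = 0" using nz by (simp add: c0_def)
  hence "[:- lam i, 1:] dvd p - Polynomial.smult c0 q" by (simp only: poly_eq_0_iff_dvd)
  then obtain p' where p': "p - Polynomial.smult c0 q = [:- lam i, 1:] * p'" by (rule dvdE)
  have sum_r: "sum r I = r i + sum r (I - {i})" by (rule sum.remove[OF I i(1)])
  have "sum r' I = r' i + sum r' (I - {i})" by (rule sum.remove[OF I i(1)])
  moreover have "sum r' (I - {i}) = sum r (I - {i})" by (rule sum.cong) (auto simp: r'_def)
  ultimately have N: "sum r' I = N" using sum_r Suc.hyps(2) i by (simp add: r'_def)
  have "degree q \<le> sum r (I - {i})"
    unfolding q_def using degree_prod_sum_le[of "I - {i}" "\<lambda>l. [:- lam l, 1:] ^ r l"] I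
    by (simp add: degree_linear_power o_def)
  hence dq: "degree (Polynomial.smult c0 q) \<le> N"
    using sum_r Suc.hyps(2) i degree_smult_le[of c0 q] by linarith
  have dp: "degree p \<le> N" using Suc.prems Suc.hyps(2) by auto
  have "degree (p - Polynomial.smult c0 q) \<le> N" by (rule degree_diff_le[OF dp dq])
  moreover have "degree ([:- lam i, 1:] * p') = Suc (degree p')" if "p' \<noteq> 0"
    using that by (subst degree_mult_eq) auto
  ultimately have "p' = 0 \<or> degree p' < N" unfolding p' by force
  with Suc.hyps(1)[of r' p'] N obtain c where c: "\<And>s. s \<notin> lam ` I \<Longrightarrow>
      poly p' s / (\<Prod>i\<in>I. (s - lam i) ^ r' i) = (\<Sum>i\<in>I. \<Sum>j=1..r' i. c i j / (s - lam i) ^ j)"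
    by auto
  define c' where "c' = c(i := (c i)(r i := c0))"
  show ?case
  proof (intro exI[of _ c'] allI impI)
    fix s assume s: "s \<notin> lam ` I"
    have x: "s - lam i \<noteq> 0" using s i by auto
    have qs: "poly q s \<noteq> 0"
      using s I by (auto simp: q_def poly_prod prod_zero_iff)
    have prod_q: "(\<Prod>l\<in>I-{i}. (s - lam l) ^ t l) = poly q s" if "\<And>l. l \<noteq> i \<Longrightarrow> t l = r l" for t
      using that unfolding q_def poly_prod by (intro prod.cong) auto
    have P: "(\<Prod>l\<in>I. (s - lam l) ^ r l) = (s - lam i) ^ r i * poly q s"
      using prod.remove[OF I i(1), of "\<lambda>l. (s - lam l) ^ r l"] prod_q[of r] by simp
    have P': "(\<Prod>l\<in>I. (s - lam l) ^ r' l) = (s - lam i) ^ (r i - 1) * poly q s"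
      using prod.remove[OF I i(1), of "\<lambda>l. (s - lam l) ^ r' l"] prod_q[of r']
      by (simp add: r'_def)
    have "poly p s = poly (Polynomial.smult c0 q + [:- lam i, 1:] * p') s"
      by (simp only: p'[symmetric]) simp
    hence ps: "poly p s = c0 * poly q s + (s - lam i) * poly p' s"
      by (simp add: algebra_simps)
    have pow: "(s - lam i) ^ r i = (s - lam i) * (s - lam i) ^ (r i - 1)"
      using i by (simp flip: power_Suc)
    have "poly p s / (\<Prod>l\<in>I. (s - lam l) ^ r l) =
       c0 / (s - lam i) ^ r i + poly p' s / (\<Prod>l\<in>I. (s - lam l) ^ r' l)"
      unfolding P P' ps pow using x qs by (simp add: add_divide_distrib)
    also have "poly p' s / (\<Prod>l\<in>I. (s - lam l) ^ r' l) =
       (\<Sum>l\<in>I. \<Sum>j=1..r' l. c l j / (s - lam l) ^ j)" by (rule c[OF s])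
    also have "\<dots> = (\<Sum>j=1..r i - 1. c i j / (s - lam i) ^ j) +
        (\<Sum>l\<in>I-{i}. \<Sum>j=1..r' l. c l j / (s - lam l) ^ j)"
      by (subst sum.remove[OF I i(1)]) (simp add: r'_def)
    also have "(\<Sum>l\<in>I-{i}. \<Sum>j=1..r' l. c l j / (s - lam l) ^ j) =
        (\<Sum>l\<in>I-{i}. \<Sum>j=1..r l. c' l j / (s - lam l) ^ j)"
      by (rule sum.cong) (auto simp: r'_def c'_def)
    also have "(\<Sum>j=1..r i - 1. c i j / (s - lam i) ^ j) =
        (\<Sum>j=1..r i - 1. c' i j / (s - lam i) ^ j)"
      using i by (intro sum.cong) (auto simp: c'_def)
    also have "c0 / (s - lam i) ^ r i + ((\<Sum>j=1..r i - 1. c' i j / (s - lam i) ^ j) + 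
        (\<Sum>l\<in>I-{i}. \<Sum>j=1..r l. c' l j / (s - lam l) ^ j)) =
       (\<Sum>j=1..Suc (r i - 1). c' i j / (s - lam i) ^ j) +
        (\<Sum>l\<in>I-{i}. \<Sum>j=1..r l. c' l j / (s - lam l) ^ j)"
    proof -
      obtain t where "r i = Suc t" using i(2) by (cases "r i") auto
      thus ?thesis by (simp add: c'_def)
    qed
    also have "\<dots> = (\<Sum>l\<in>I. \<Sum>j=1..r l. c' l j / (s - lam l) ^ j)"
      using i by (subst sum.remove[OF I i(1)]) simp
    finally show "poly p s / (\<Prod>l\<in>I. (s - lam l) ^ r l) =
      (\<Sum>l\<in>I. \<Sum>j=1..r l. c' l j / (s - lam l) ^ j)" .
  qed
qed

section \<open>The resolvent as a matrix of rational functions\<close>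

text \<open>\<^const>\<open>mat_inverse\<close> runs Gauss-Jordan elimination; this lemma reduces its value to a one-sided
  matrix equation.\<close>

lemma mat_inverse_eq_Some:
  fixes M :: "'a::field mat"
  assumes M: "M \<in> carrier_mat n n" and X: "X \<in> carrier_mat n n" and MX: "M * X = 1\<^sub>m n"
  shows "mat_inverse M = Some X"
proof (cases "mat_inverse M")
  case None
  have "X * M = 1\<^sub>m n" by (rule mat_mult_left_right_inverse[OF M X MX])
  hence "M \<in> Units (ring_mat TYPE('a) n ())"
    using M X MX by (auto simp: Units_def ring_mat_simps)
  thus ?thesis using mat_inverse(1)[OF M None, of "()"] by blast
next
  case (Some Y)
  note Y = mat_inverse(2)[OF M Some]
  hence Yc: "Y \<in> carrier_mat n n" and YM: "Y * M = 1\<^sub>m n" by auto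
  have "Y = Y * (M * X)" unfolding MX using right_mult_one_mat[OF Yc] by simp
  also have "\<dots> = (Y * M) * X" using assoc_mult_mat[OF Yc M X] by simp
  also have "\<dots> = X" unfolding YM using X by simp
  finally show ?thesis using Some by simp
qed

lemma finsum_mat_closed:
  assumes "\<And>i. i \<in> I \<Longrightarrow> f i \<in> carrier_mat nr nc"
  shows "(\<Oplus>\<^bsub>module_mat TYPE('a::comm_ring_1) nr nc\<^esub>i\<in>I. f i) \<in> carrier_mat nr nc"
proof -
  interpret abelian_group "module_mat TYPE('a) nr nc" by (rule abelian_group_mat)
  show ?thesis using finsum_closed[of f I] assms by (auto simp: module_mat_simps)
qed

lemma index_finsum_mat:
  assumes I: "finite I" and f: "\<And>i. i \<in> I \<Longrightarrow> f i \<in> carrier_mat nr nc"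
    and ab: "a < nr" "b < nc"
  shows "(\<Oplus>\<^bsub>module_mat TYPE('a::comm_ring_1) nr nc\<^esub>i\<in>I. f i) $$ (a, b) = (\<Sum>i\<in>I. f i $$ (a, b))"
  using I f
proof (induction I rule: finite_induct)
  case empty
  interpret abelian_group "module_mat TYPE('a) nr nc" by (rule abelian_group_mat)
  show ?case using ab by (simp add: module_mat_simps)
next
  case (insert i I)
  interpret abelian_group "module_mat TYPE('a) nr nc" by (rule abelian_group_mat)
  have "(\<Oplus>\<^bsub>module_mat TYPE('a) nr nc\<^esub>i\<in>insert i I. f i) =
    f i + (\<Oplus>\<^bsub>module_mat TYPE('a) nr nc\<^esub>i\<in>I. f i)"
    using insert by (subst finsum_insert) (auto simp: module_mat_simps)
  moreover have "(\<Oplus>\<^bsub>module_mat TYPE('a) nr nc\<^esub>i\<in>I. f i) \<in> carrier_mat nr nc"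
    by (rule finsum_mat_closed) (use insert in auto)
  ultimately show ?case using insert ab by auto
qed

lemma pfd_sum_carrier:
  fixes B :: "nat \<times> nat \<Rightarrow> 'a::field mat"
  assumes B: "\<And>i j. i \<in> {1..k} \<Longrightarrow> j \<in> {1..r i} \<Longrightarrow> B (i, j) \<in> carrier_mat n n"
  shows "(\<Oplus>\<^bsub>module_mat TYPE('a) n n\<^esub>i\<in>{1..k}. \<Oplus>\<^bsub>module_mat TYPE('a) n n\<^esub>j\<in>{1..r i}.
    (1 / (s - lam i) ^ j) \<cdot>\<^sub>m B (i, j)) \<in> carrier_mat n n"
  by (intro finsum_mat_closed smult_carrier_mat B)

lemma index_pfd_sum:
  fixes B :: "nat \<times> nat \<Rightarrow> 'a::field mat"
  assumes B: "\<And>i j. i \<in> {1..k} \<Longrightarrow> j \<in> {1..r i} \<Longrightarrow> B (i, j) \<in> carrier_mat n n"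
    and ab: "a < n" "b < n"
  shows "(\<Oplus>\<^bsub>module_mat TYPE('a) n n\<^esub>i\<in>{1..k}. \<Oplus>\<^bsub>module_mat TYPE('a) n n\<^esub>j\<in>{1..r i}.
      (1 / (s - lam i) ^ j) \<cdot>\<^sub>m B (i, j)) $$ (a, b) =
    (\<Sum>i=1..k. \<Sum>j=1..r i. B (i, j) $$ (a, b) / (s - lam i) ^ j)" (is "?R $$ _ = _")
proof -
  have C: "(1 / (s - lam i) ^ j) \<cdot>\<^sub>m B (i, j) \<in> carrier_mat n n" if "i \<in> {1..k}" "j \<in> {1..r i}" for i j
    by (rule smult_carrier_mat[OF B[OF that]])
  have "?R $$ (a, b) = (\<Sum>i=1..k. (\<Oplus>\<^bsub>module_mat TYPE('a) n n\<^esub>j\<in>{1..r i}.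
      (1 / (s - lam i) ^ j) \<cdot>\<^sub>m B (i, j)) $$ (a, b))"
    by (rule index_finsum_mat[OF finite_atLeastAtMost _ ab], rule finsum_mat_closed, rule C)
  also have "\<dots> = (\<Sum>i=1..k. \<Sum>j=1..r i. ((1 / (s - lam i) ^ j) \<cdot>\<^sub>m B (i, j)) $$ (a, b))"
    by (intro sum.cong refl index_finsum_mat[OF finite_atLeastAtMost _ ab] C)
  also have "\<dots> = (\<Sum>i=1..k. \<Sum>j=1..r i. B (i, j) $$ (a, b) / (s - lam i) ^ j)"
  proof (intro sum.cong refl)
    fix i j assume "i \<in> {1..k}" "j \<in> {1..r i}"
    from B[OF this] ab
    show "((1 / (s - lam i) ^ j) \<cdot>\<^sub>m B (i, j)) $$ (a, b) = B (i, j) $$ (a, b) / (s - lam i) ^ j"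
      by simp
  qed
  finally show ?thesis .
qed

text \<open>The entries of the adjugate are, up to sign, minors of size \<open>n - 1\<close> of a matrix whose entries have
  degree at most one. This is what makes the entries of the resolvent proper rational functions.\<close>

lemma degree_adj_char_poly_matrix:
  fixes A :: "'a::field mat"
  assumes A: "A \<in> carrier_mat n n" and a: "a < n" and b: "b < n"
  shows "degree (adj_mat (char_poly_matrix A) $$ (a, b)) < n"
proof -
  let ?M = "mat_delete (char_poly_matrix A) b a"
  have C: "char_poly_matrix A \<in> carrier_mat n n" using A by simp
  have M: "?M \<in> carrier_mat (n - 1) (n - 1)" by (rule mat_delete_carrier[OF C])
  have "degree (char_poly_matrix A $$ (i, j)) \<le> 1" if "i < n" "j < n" for i j
    using that A by (auto simp: char_poly_matrix_def)
  hence "degree (?M $$ (i, j)) \<le> 1" if "i < n - 1" "j < n - 1" for i j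
    using that C by (auto simp: mat_delete_def)
  hence "degree (det ?M) \<le> 1 * (n - 1)" by (rule degree_det_le[OF _ M])
  moreover have "degree ((-1) ^ (b + a) * det ?M) = degree (det ?M)"
    by (cases "even (b + a)") auto
  ultimately show ?thesis using a b C by (simp add: adj_mat_def cofactor_def)
qed

text \<open>The identity between a matrix and its adjugate over the polynomial ring, evaluated at \<open>s\<close>.\<close>

lemma adj_char_poly_matrix_eval:
  fixes A :: "'a::field mat"
  assumes A: "A \<in> carrier_mat n n"
  shows "(s \<cdot>\<^sub>m 1\<^sub>m n - A) * map_mat (\<lambda>p. poly p s) (adj_mat (char_poly_matrix A)) =
    poly (char_poly A) s \<cdot>\<^sub>m 1\<^sub>m n"
proof (rule eq_matI)
  let ?C = "char_poly_matrix A"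
  have C: "?C \<in> carrier_mat n n" using A by simp
  note adj = adj_mat[OF C]
  fix a b assume "a < dim_row (poly (char_poly A) s \<cdot>\<^sub>m 1\<^sub>m n)" "b < dim_col (poly (char_poly A) s \<cdot>\<^sub>m 1\<^sub>m n)"
  hence ab: "a < n" "b < n" by auto
  have "((s \<cdot>\<^sub>m 1\<^sub>m n - A) * map_mat (\<lambda>p. poly p s) (adj_mat ?C)) $$ (a, b) =
    (\<Sum>c<n. poly (?C $$ (a, c)) s * poly (adj_mat ?C $$ (c, b)) s)"
    using ab A adj(1) by (auto simp: scalar_prod_def char_poly_matrix_def lessThan_atLeast0 intro!: sum.cong)
  also have "\<dots> = poly ((?C * adj_mat ?C) $$ (a, b)) s"
    using ab C adj(1) by (auto simp: scalar_prod_def poly_sum lessThan_atLeast0 intro!: sum.cong)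
  also have "\<dots> = (poly (char_poly A) s \<cdot>\<^sub>m 1\<^sub>m n) $$ (a, b)"
    unfolding adj(2) using ab by (simp add: char_poly_def)
  finally show "((s \<cdot>\<^sub>m 1\<^sub>m n - A) * map_mat (\<lambda>p. poly p s) (adj_mat ?C)) $$ (a, b) =
    (poly (char_poly A) s \<cdot>\<^sub>m 1\<^sub>m n) $$ (a, b)" .
qed (use A adj_mat(1)[of "char_poly_matrix A" n] in auto)

lemma char_poly_eq_prod:
  fixes A :: "complex mat"
  assumes A: "A \<in> carrier_mat n n" and bij: "bij_betw lam I {e. eigenvalue A e}"
    and r: "\<And>i. i \<in> I \<Longrightarrow> r i = Polynomial.order (lam i) (char_poly A)"
  shows "char_poly A = (\<Prod>i\<in>I. [:- lam i, 1:] ^ r i)"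
proof -
  have "char_poly A = (\<Prod>z | poly (char_poly A) z = 0. [:- z, 1:] ^ Polynomial.order z (char_poly A))"
    using complex_poly_decompose[of "char_poly A"] degree_monic_char_poly[OF A] by simp
  also have "{z. poly (char_poly A) z = 0} = {e. eigenvalue A e}"
    using eigenvalue_root_char_poly[OF A] by auto
  also have "(\<Prod>z\<in>{e. eigenvalue A e}. [:- z, 1:] ^ Polynomial.order z (char_poly A)) = 
     (\<Prod>i\<in>I. [:- lam i, 1:] ^ Polynomial.order (lam i) (char_poly A))"
    by (rule prod.reindex_bij_betw[OF bij, symmetric])
  also have "\<dots> = (\<Prod>i\<in>I. [:- lam i, 1:] ^ r i)" using r by simp
  finally show ?thesis .
qed


text \<open>Each entry of the adjugate divided by the characteristic polynomial is expanded separately; the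
  coefficients, collected over the entries, form the matrices.\<close>

lemma resolvent_pfd_exists:
  assumes A: "A \<in> carrier_mat n n" and bij: "bij_betw lam {1..k} {e. eigenvalue A e}"
    and r: "\<And>i. i \<in> {1..k} \<Longrightarrow> r i = Polynomial.order (lam i) (char_poly A)"
  shows "\<exists>B. resolvent_pfd n A k lam r B"
proof -
  let ?I = "{1..k}" and ?adj = "adj_mat (char_poly_matrix A)"
  have inj: "inj_on lam ?I" using bij by (rule bij_betw_imp_inj_on)
  have C: "char_poly_matrix A \<in> carrier_mat n n" using A by simp
  have chi: "char_poly A = (\<Prod>i\<in>?I. [:- lam i, 1:] ^ r i)" by (rule char_poly_eq_prod[OF A bij r])
  have chi_s: "poly (char_poly A) s = (\<Prod>i\<in>?I. (s - lam i) ^ r i)" for s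
    unfolding chi by (simp add: poly_prod)
  have "n = degree (char_poly A)" using degree_monic_char_poly[OF A] by simp
  also have "\<dots> = sum r ?I"
    unfolding chi by (subst degree_prod_sum_eq) (auto simp: degree_linear_power)
  finally have n: "n = sum r ?I" .
  \<comment> \<open>Naming the property lets the coefficients be chosen separately for each entry \<open>(a, b)\<close>.\<close>
  define expands where "expands a b c \<longleftrightarrow> (\<forall>s. s \<notin> lam ` ?I \<longrightarrow>
      poly (?adj $$ (a, b)) s / (\<Prod>i\<in>?I. (s - lam i) ^ r i) =
      (\<Sum>i\<in>?I. \<Sum>j=1..r i. c i j / (s - lam i) ^ j))" for a b and c :: "nat \<Rightarrow> nat \<Rightarrow> complex"
  define c where "c a b = (SOME c. expands a b c)" for a b
  have "expands a b (c a b)" if "a < n" "b < n" for a b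
    unfolding c_def
  proof (rule someI_ex[where P = "expands a b"])
    show "\<exists>c. expands a b c"
      unfolding expands_def by (rule partial_fractions_exist[OF _ inj])
        (use degree_adj_char_poly_matrix[OF A that] n in auto)
  qed
  hence c: "poly (?adj $$ (a, b)) s / (\<Prod>i\<in>?I. (s - lam i) ^ r i) =
      (\<Sum>i\<in>?I. \<Sum>j=1..r i. c a b i j / (s - lam i) ^ j)"
    if "a < n" "b < n" "s \<notin> lam ` ?I" for a b s
    using that by (simp add: expands_def)
  define B where "B = (\<lambda>(i, j)\<in>(SIGMA i:?I. {1..r i}). mat n n (\<lambda>(a, b). c a b i j))"
  have B: "B (i, j) = mat n n (\<lambda>(a, b). c a b i j)" if "i \<in> ?I" "j \<in> {1..r i}" for i j
    using that by (simp add: B_def)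
  have BC: "B (i, j) \<in> carrier_mat n n" if "i \<in> ?I" "j \<in> {1..r i}" for i j
    unfolding B[OF that] by simp
  have "resolvent_pfd n A k lam r B"
    unfolding resolvent_pfd_def
  proof (intro conjI allI impI)
    show "B \<in> (SIGMA i:?I. {1..r i}) \<rightarrow>\<^sub>E carrier_mat n n"
      unfolding B_def by (auto simp: restrict_def)
    fix s assume s: "s \<notin> lam ` ?I"
    let ?M = "s \<cdot>\<^sub>m 1\<^sub>m n - A" and ?chi = "poly (char_poly A) s"
    let ?P = "map_mat (\<lambda>p. poly p s) ?adj"
    let ?X = "\<Oplus>\<^bsub>module_mat TYPE(complex) n n\<^esub>i\<in>?I. \<Oplus>\<^bsub>module_mat TYPE(complex) n n\<^esub>j\<in>{1..r i}.
      (1 / (s - lam i) ^ j) \<cdot>\<^sub>m B (i, j)"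
    have nz: "?chi \<noteq> 0" using s unfolding chi_s by (auto simp: prod_zero_iff)
    have M: "?M \<in> carrier_mat n n" using A by (intro minus_carrier_mat)
    have P: "?P \<in> carrier_mat n n" using adj_mat(1)[OF C] by simp
    have XC: "?X \<in> carrier_mat n n" by (rule pfd_sum_carrier[where k = k and r = r and B = B]) (rule BC)
    have X: "?X = (1 / ?chi) \<cdot>\<^sub>m ?P"
    proof (rule eq_matI)
      fix a b assume "a < dim_row ((1 / ?chi) \<cdot>\<^sub>m ?P)" "b < dim_col ((1 / ?chi) \<cdot>\<^sub>m ?P)"
      hence ab: "a < n" "b < n" using P by auto
      have "?X $$ (a, b) = (\<Sum>i\<in>?I. \<Sum>j=1..r i. B (i, j) $$ (a, b) / (s - lam i) ^ j)"
        by (rule index_pfd_sum[where k = k and r = r and B = B, OF _ ab]) (rule BC)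
      also have "\<dots> = (\<Sum>i\<in>?I. \<Sum>j=1..r i. c a b i j / (s - lam i) ^ j)"
        using ab by (intro sum.cong refl) (simp add: B)
      also have "\<dots> = poly (?adj $$ (a, b)) s / ?chi" unfolding chi_s by (rule c[OF ab s, symmetric])
      also have "\<dots> = ((1 / ?chi) \<cdot>\<^sub>m ?P) $$ (a, b)"
        using ab adj_mat(1)[OF C] by simp
      finally show "?X $$ (a, b) = ((1 / ?chi) \<cdot>\<^sub>m ?P) $$ (a, b)" .
    qed (use XC P in auto)
    have "?M * ?X = (1 / ?chi) \<cdot>\<^sub>m (?M * ?P)" unfolding X by (rule mult_smult_distrib[OF M P])
    also have "\<dots> = 1\<^sub>m n"
      unfolding adj_char_poly_matrix_eval[OF A] using nz by (intro eq_matI) auto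
    finally show "mat_inverse ?M = Some ?X" by (rule mat_inverse_eq_Some[OF M XC])
  qed
  thus ?thesis by blast
qed

lemma resolvent_pfd_unique:
  assumes inj: "inj_on lam {1..k}"
    and B: "resolvent_pfd n A k lam r B" and B': "resolvent_pfd n A k lam r B'"
  shows "B = B'"
proof -
  have F: "B \<in> (SIGMA i:{1..k}. {1..r i}) \<rightarrow>\<^sub>E carrier_mat n n"
      "B' \<in> (SIGMA i:{1..k}. {1..r i}) \<rightarrow>\<^sub>E carrier_mat n n"
    using B B' unfolding resolvent_pfd_def by auto
  have C: "B (i, j) \<in> carrier_mat n n" "B' (i, j) \<in> carrier_mat n n"
    if "i \<in> {1..k}" "j \<in> {1..r i}" for i j
    using PiE_mem[OF F(1), of "(i, j)"] PiE_mem[OF F(2), of "(i, j)"] that by auto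
  show ?thesis
  proof (rule PiE_ext[OF F])
    fix x assume "x \<in> (SIGMA i:{1..k}. {1..r i})"
    then obtain i j where x: "x = (i, j)" and ij: "i \<in> {1..k}" "j \<in> {1..r i}" by auto
    have "B (i, j) = B' (i, j)"
    proof (rule eq_matI)
      fix a b assume "a < dim_row (B' (i, j))" "b < dim_col (B' (i, j))"
      hence ab: "a < n" "b < n" using C(2)[OF ij] by auto
      have "B (i, j) $$ (a, b) - B' (i, j) $$ (a, b) = 0"
      proof (rule partial_fractions_unique[where I = "{1..k}" and lam = lam and r = r and i = i and j = j
          and c = "\<lambda>i j. B (i, j) $$ (a, b) - B' (i, j) $$ (a, b)" and d = 0])
        fix s assume s: "s \<notin> lam ` {1..k}"
        have "(\<Oplus>\<^bsub>module_mat TYPE(complex) n n\<^esub>i\<in>{1..k}. \<Oplus>\<^bsub>module_mat TYPE(complex) n n\<^esub>j\<in>{1..r i}.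
            (1 / (s - lam i) ^ j) \<cdot>\<^sub>m B (i, j)) =
          (\<Oplus>\<^bsub>module_mat TYPE(complex) n n\<^esub>i\<in>{1..k}. \<Oplus>\<^bsub>module_mat TYPE(complex) n n\<^esub>j\<in>{1..r i}.
            (1 / (s - lam i) ^ j) \<cdot>\<^sub>m B' (i, j))" (is "?X = ?X'")
        proof -
          have "mat_inverse (s \<cdot>\<^sub>m 1\<^sub>m n - A) = Some ?X" "mat_inverse (s \<cdot>\<^sub>m 1\<^sub>m n - A) = Some ?X'"
            using B B' s unfolding resolvent_pfd_def by blast+
          thus ?thesis by simp
        qed
        hence "?X $$ (a, b) = ?X' $$ (a, b)" by simp
        thus "(\<Sum>i=1..k. \<Sum>j=1..r i. (B (i, j) $$ (a, b) - B' (i, j) $$ (a, b)) / (s - lam i) ^ j) = 0"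
        proof -
          note idx = index_pfd_sum[where k = k and r = r and n = n and s = s and lam = lam, OF _ ab]
          have "?X $$ (a, b) = (\<Sum>i=1..k. \<Sum>j=1..r i. B (i, j) $$ (a, b) / (s - lam i) ^ j)"
            by (rule idx[of B]) (rule C(1))
          moreover have "?X' $$ (a, b) = (\<Sum>i=1..k. \<Sum>j=1..r i. B' (i, j) $$ (a, b) / (s - lam i) ^ j)"
            by (rule idx[of B']) (rule C(2))
          ultimately show ?thesis
            using \<open>?X $$ (a, b) = ?X' $$ (a, b)\<close> by (simp only: diff_divide_distrib sum_subtractf diff_self)
        qed
      qed (use inj ij in simp_all)
      thus "B (i, j) $$ (a, b) = B' (i, j) $$ (a, b)" by simp
    qed (use C[OF ij] in auto)
    thus "B x = B' x" by (simp add: x)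
  qed
qed

section \<open>Consequences of a partial fraction decomposition of the resolvent\<close>

lemma index_mult_mat_sum:
  assumes "X \<in> carrier_mat nr n" "Y \<in> carrier_mat n nc" "a < nr" "b < nc"
  shows "(X * Y) $$ (a, b) = (\<Sum>c<n. X $$ (a, c) * Y $$ (c, b))"
  using assms by (auto simp: scalar_prod_def lessThan_atLeast0 intro!: sum.cong)

lemma index_mult_vec_sum:
  assumes "X \<in> carrier_mat nr n" "v \<in> carrier_vec n" "a < nr"
  shows "(X *\<^sub>v v) $ a = (\<Sum>c<n. X $$ (a, c) * v $ c)"
  using assms by (auto simp: scalar_prod_def lessThan_atLeast0 intro!: sum.cong)

lemma pow_mat_mult_vec_add:
  fixes N :: "'a::comm_ring_1 mat"
  assumes N: "N \<in> carrier_mat n n" and v: "v \<in> carrier_vec n"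
  shows "(N ^\<^sub>m (p + q)) *\<^sub>v v = (N ^\<^sub>m p) *\<^sub>v ((N ^\<^sub>m q) *\<^sub>v v)"
  using v
proof (induction q arbitrary: v)
  case 0
  thus ?case using N by simp
next
  case (Suc q)
  have P: "N ^\<^sub>m t \<in> carrier_mat n n" for t using N by simp
  have "(N ^\<^sub>m (p + Suc q)) *\<^sub>v v = (N ^\<^sub>m (p + q)) *\<^sub>v (N *\<^sub>v v)"
    using assoc_mult_mat_vec[OF P N Suc.prems] by simp
  also have "\<dots> = (N ^\<^sub>m p) *\<^sub>v ((N ^\<^sub>m q) *\<^sub>v (N *\<^sub>v v))"
    by (rule Suc.IH) (use N Suc.prems in auto)
  also have "(N ^\<^sub>m q) *\<^sub>v (N *\<^sub>v v) = (N ^\<^sub>m Suc q) *\<^sub>v v"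
    using assoc_mult_mat_vec[OF P N Suc.prems] by simp
  finally show ?case .
qed

lemma mult_vec_pow_mat:
  fixes N :: "'a::comm_ring_1 mat"
  assumes N: "N \<in> carrier_mat n n" and v: "v \<in> carrier_vec n"
  shows "N *\<^sub>v ((N ^\<^sub>m q) *\<^sub>v v) = (N ^\<^sub>m Suc q) *\<^sub>v v"
  using pow_mat_mult_vec_add[OF N v, of 1 q] N by simp

text \<open>This lets a generalized eigenvector be used with any exponent above its rank.\<close>

lemma pow_mat_mult_zero_vec_mono:
  fixes N :: "'a::comm_ring_1 mat"
  assumes N: "N \<in> carrier_mat n n" and v: "v \<in> carrier_vec n"
    and 0: "(N ^\<^sub>m p) *\<^sub>v v = 0\<^sub>v n" and "p \<le> q"
  shows "(N ^\<^sub>m q) *\<^sub>v v = 0\<^sub>v n"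
proof -
  have "(N ^\<^sub>m (q - p)) *\<^sub>v 0\<^sub>v n = 0\<^sub>v n" using N by (intro eq_vecI) auto
  thus ?thesis using pow_mat_mult_vec_add[OF N v, of "q - p" p] assms(4) 0 by simp
qed

text \<open>A sequence that stays at \<open>z\<close> once it gets there is cut by the filter to an initial segment, and
  the first discarded value, if there is one, is \<open>z\<close>. Applied to the columns of the coefficients,
  this says that dropping the zero columns leaves no gaps in the chain.\<close>

lemma filter_nonzero_prefix:
  fixes f :: "nat \<Rightarrow> 'a"
  assumes "\<And>j. 1 \<le> j \<Longrightarrow> j < r \<Longrightarrow> f j = z \<Longrightarrow> f (Suc j) = z"
  shows "\<exists>t\<le>r. filter (\<lambda>v. v \<noteq> z) (map f [1..<r + 1]) = map f [1..<t + 1] \<and>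
    (\<forall>j. 1 \<le> j \<and> j \<le> t \<longrightarrow> f j \<noteq> z) \<and> (t < r \<longrightarrow> f (Suc t) = z)"
  using assms
proof (induction r)
  case 0
  thus ?case by simp
next
  case (Suc r)
  from Suc.IH Suc.prems obtain t where t: "t \<le> r"
    "filter (\<lambda>v. v \<noteq> z) (map f [1..<r + 1]) = map f [1..<t + 1]"
    "\<And>j. 1 \<le> j \<Longrightarrow> j \<le> t \<Longrightarrow> f j \<noteq> z" "t < r \<Longrightarrow> f (Suc t) = z"
    by force
  have split: "filter (\<lambda>v. v \<noteq> z) (map f [1..<Suc r + 1]) =
      map f [1..<t + 1] @ (if f (Suc r) = z then [] else [f (Suc r)])"
    using t(2) by simp
  show ?case
  proof (cases "f (Suc r) = z")
    case True
    thus ?thesis using split t by (intro exI[of _ t]) (auto simp: le_less)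
  next
    case False
    have "t = r"
    proof (rule ccontr)
      assume "t \<noteq> r"
      hence tr: "t < r" using t(1) by simp
      have "f j = z" if "Suc t \<le> j" "j \<le> Suc r" for j
        using that
      proof (induction j rule: dec_induct)
        case base
        show ?case using t(4) tr by simp
      next
        case (step j)
        thus ?case using Suc.prems[of j] by simp
      qed
      thus False using False tr by simp
    qed
    thus ?thesis using split t False
      by (intro exI[of _ "Suc r"]) (auto simp: le_Suc_eq)
  qed
qed

text \<open>The hypothesis \<open>r_pos\<close> is what makes the index \<open>r i\<close> a valid one; it expresses that every \<open>lam i\<close> is a
  root of the characteristic polynomial.\<close>

locale resolvent_expansion =
  fixes n k :: nat and A :: "complex mat" and lam :: "nat \<Rightarrow> complex" and r :: "nat \<Rightarrow> nat"
    and B :: "nat \<times> nat \<Rightarrow> complex mat"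
  assumes A: "A \<in> carrier_mat n n"
    and inj: "inj_on lam {1..k}"
    and pfd: "resolvent_pfd n A k lam r B"
    and r_pos: "\<And>i. i \<in> {1..k} \<Longrightarrow> 1 \<le> r i"
begin

abbreviation N where "N i \<equiv> char_matrix A (lam i)"

definition R where "R s = (\<Oplus>\<^bsub>module_mat TYPE(complex) n n\<^esub>i\<in>{1..k}.
  \<Oplus>\<^bsub>module_mat TYPE(complex) n n\<^esub>j\<in>{1..r i}. (1 / (s - lam i) ^ j) \<cdot>\<^sub>m B (i, j))"

lemma N_carrier: "N i \<in> carrier_mat n n"
  using A by simp

lemma B_carrier: "i \<in> {1..k} \<Longrightarrow> j \<in> {1..r i} \<Longrightarrow> B (i, j) \<in> carrier_mat n n"
  using pfd unfolding resolvent_pfd_def by (blast dest: PiE_mem)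

lemma R_carrier: "R s \<in> carrier_mat n n"
  unfolding R_def by (rule pfd_sum_carrier[where k = k and r = r and B = B]) (rule B_carrier)

lemma index_R:
  assumes "a < n" "b < n"
  shows "R s $$ (a, b) = (\<Sum>i=1..k. \<Sum>j=1..r i. B (i, j) $$ (a, b) / (s - lam i) ^ j)"
  unfolding R_def by (rule index_pfd_sum[where k = k and r = r and B = B]) (use assms in \<open>auto intro: B_carrier\<close>)

lemma R_inverse:
  assumes s: "s \<notin> lam ` {1..k}"
  shows "(s \<cdot>\<^sub>m 1\<^sub>m n - A) * R s = 1\<^sub>m n" "R s * (s \<cdot>\<^sub>m 1\<^sub>m n - A) = 1\<^sub>m n"
proof -
  have "mat_inverse (s \<cdot>\<^sub>m 1\<^sub>m n - A) = Some (R s)"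
    using pfd s unfolding resolvent_pfd_def R_def by blast
  moreover have "s \<cdot>\<^sub>m 1\<^sub>m n - A \<in> carrier_mat n n" using A by (intro minus_carrier_mat)
  ultimately show "(s \<cdot>\<^sub>m 1\<^sub>m n - A) * R s = 1\<^sub>m n" "R s * (s \<cdot>\<^sub>m 1\<^sub>m n - A) = 1\<^sub>m n"
    using mat_inverse(2) by blast+
qed

text \<open>The identity \<open>s I - A = (s - lam i) I - N i\<close>, read entrywise. It holds for every \<open>i\<close> and so can
  be applied to each principal part with the pole of that part.\<close>

lemma resolvent_mult_index:
  assumes x: "x \<in> carrier_vec n" and a: "a < n"
  shows "((s \<cdot>\<^sub>m 1\<^sub>m n - A) *\<^sub>v x) $ a = (s - lam i) * x $ a - (N i *\<^sub>v x) $ a"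
proof -
  have "((s \<cdot>\<^sub>m 1\<^sub>m n - A) *\<^sub>v x) $ a = (\<Sum>c<n. (s * (if a = c then 1 else 0) - A $$ (a, c)) * x $ c)"
    using x a A by (auto simp: scalar_prod_def lessThan_atLeast0 intro!: sum.cong)
  also have "\<dots> = (\<Sum>c<n. (s - lam i) * (if a = c then x $ c else 0) - 
      (A $$ (a, c) - lam i * (if a = c then 1 else 0)) * x $ c)"
    by (intro sum.cong) (auto simp: algebra_simps)
  also have "\<dots> = (s - lam i) * x $ a - (\<Sum>c<n. (A $$ (a, c) - lam i * (if a = c then 1 else 0)) * x $ c)"
    using a by (simp add: sum_subtractf flip: sum_distrib_left)
  also have "(\<Sum>c<n. (A $$ (a, c) - lam i * (if a = c then 1 else 0)) * x $ c) = (N i *\<^sub>v x) $ a"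
    using x a A by (auto simp: scalar_prod_def char_matrix_def lessThan_atLeast0 intro!: sum.cong)
  finally show ?thesis .
qed

text \<open>Comparison of coefficients in \<open>(s I - A) R s = I\<close>. In the principal part at \<open>lam i\<close>, the factor
  \<open>s - lam i\<close> lowers every exponent by one, which puts \<open>B (i, j + 1)\<close> next to \<open>N i B (i, j)\<close>; the
  terms with \<open>j = 1\<close> become constant and join the identity matrix on the other side.\<close>

lemma char_matrix_mult_col:
  assumes i: "i \<in> {1..k}" and j: "j \<in> {1..r i}" and m: "m < n"
  shows "N i *\<^sub>v col (B (i, j)) m = (if j < r i then col (B (i, Suc j)) m else 0\<^sub>v n)"
proof (rule eq_vecI)
  \<comment> \<open>Extending the columns by zero beyond \<open>r i\<close> removes the special case at the end of the shift.\<close>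
  define f where "f i j = (if j \<le> r i then col (B (i, j)) m else 0\<^sub>v n)" for i j
  have f: "f i j \<in> carrier_vec n" if "i \<in> {1..k}" "1 \<le> j" for i j
    using B_carrier[of i j] that by (auto simp: f_def intro!: col_carrier_vec[OF m])
  fix a assume "a < dim_vec (if j < r i then col (B (i, Suc j)) m else 0\<^sub>v n)"
  hence a: "a < n" using B_carrier[OF i, of "Suc j"] j by (auto split: if_splits)
  have "f i (Suc j) $ a - (N i *\<^sub>v f i j) $ a = 0"
  proof (rule partial_fractions_unique[where I = "{1..k}" and lam = lam and r = r and i = i and j = j
      and c = "\<lambda>i j. f i (Suc j) $ a - (N i *\<^sub>v f i j) $ a"
      and d = "(if a = m then 1 else 0) - (\<Sum>i=1..k. f i 1 $ a)"])
    fix s assume s: "s \<notin> lam ` {1..k}"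
    have x: "s - lam i \<noteq> 0" if "i \<in> {1..k}" for i using s that by auto
    let ?M = "s \<cdot>\<^sub>m 1\<^sub>m n - A"
    have M: "?M \<in> carrier_mat n n" using A by (intro minus_carrier_mat)
    have "(if a = m then 1 else 0) = (?M * R s) $$ (a, m)"
      using R_inverse(1)[OF s] a m by simp
    also have "\<dots> = (\<Sum>c<n. ?M $$ (a, c) * R s $$ (c, m))"
      by (rule index_mult_mat_sum[OF M R_carrier a m])
    also have "\<dots> = (\<Sum>c<n. ?M $$ (a, c) * (\<Sum>i=1..k. \<Sum>j=1..r i. f i j $ c / (s - lam i) ^ j))"
    proof (intro sum.cong refl arg_cong2[of _ _ _ _ "(*)"])
      fix c assume c: "c \<in> {..<n}"
      show "R s $$ (c, m) = (\<Sum>i=1..k. \<Sum>j=1..r i. f i j $ c / (s - lam i) ^ j)"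
        using c m by (subst index_R) (auto simp: f_def carrier_matD[OF B_carrier] intro!: sum.cong)
    qed
    also have "\<dots> = (\<Sum>c<n. \<Sum>i=1..k. \<Sum>j=1..r i. ?M $$ (a, c) * f i j $ c / (s - lam i) ^ j)"
      by (simp add: sum_distrib_left)
    also have "\<dots> = (\<Sum>i=1..k. \<Sum>c<n. \<Sum>j=1..r i. ?M $$ (a, c) * f i j $ c / (s - lam i) ^ j)"
      by (rule sum.swap)
    also have "\<dots> = (\<Sum>i=1..k. \<Sum>j=1..r i. \<Sum>c<n. ?M $$ (a, c) * f i j $ c / (s - lam i) ^ j)"
      by (intro sum.cong refl sum.swap)
    also have "\<dots> = (\<Sum>i=1..k. \<Sum>j=1..r i. (?M *\<^sub>v f i j) $ a / (s - lam i) ^ j)"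
    proof (intro sum.cong refl)
      fix i j assume "i \<in> {1..k}" "j \<in> {1..r i}"
      hence "f i j \<in> carrier_vec n" by (intro f) auto
      thus "(\<Sum>c<n. ?M $$ (a, c) * f i j $ c / (s - lam i) ^ j) = (?M *\<^sub>v f i j) $ a / (s - lam i) ^ j"
        using a M by (simp add: index_mult_vec_sum[OF M _ a] sum_divide_distrib)
    qed
    also have "\<dots> = (\<Sum>i=1..k. f i 1 $ a +
        (\<Sum>j=1..r i. (f i (Suc j) $ a - (N i *\<^sub>v f i j) $ a) / (s - lam i) ^ j))"
    proof (intro sum.cong refl)
      fix i assume i: "i \<in> {1..k}"
      let ?g = "\<lambda>j. f i (Suc j) $ a / (s - lam i) ^ j"
      have "(\<Sum>j=1..r i. (?M *\<^sub>v f i j) $ a / (s - lam i) ^ j) =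
         (\<Sum>j=1..r i. ?g (j - 1) - (N i *\<^sub>v f i j) $ a / (s - lam i) ^ j)"
      proof (intro sum.cong refl)
        fix j assume j: "j \<in> {1..r i}"
        then obtain t where t: "j = Suc t" by (cases j) auto
        show "(?M *\<^sub>v f i j) $ a / (s - lam i) ^ j = ?g (j - 1) - (N i *\<^sub>v f i j) $ a / (s - lam i) ^ j"
          unfolding resolvent_mult_index[OF f[OF i, of j] a, of s i] using x[OF i] j
          by (subst resolvent_mult_index[OF f[OF i, of j] a, of s i])
             (auto simp: t diff_divide_distrib)
      qed
      also have "\<dots> = (\<Sum>j=1..r i. ?g (j - 1)) - (\<Sum>j=1..r i. (N i *\<^sub>v f i j) $ a / (s - lam i) ^ j)"
        by (rule sum_subtractf)
      also have "(\<Sum>j=1..r i. ?g (j - 1)) = (\<Sum>j<r i. ?g j)"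
        by (rule sum.reindex_bij_witness[of _ Suc "\<lambda>j. j - 1"]) auto
      also have "\<dots> = (\<Sum>j<Suc (r i). ?g j)"
        using a by (simp add: f_def)
      also have "\<dots> = ?g 0 + (\<Sum>j<r i. ?g (Suc j))"
        by (rule sum.lessThan_Suc_shift)
      also have "(\<Sum>j<r i. ?g (Suc j)) = (\<Sum>j=1..r i. ?g j)"
        by (rule sum.reindex_bij_witness[of _ "\<lambda>j. j - 1" Suc]) auto
      finally show "(\<Sum>j=1..r i. (?M *\<^sub>v f i j) $ a / (s - lam i) ^ j) =
        f i 1 $ a + (\<Sum>j=1..r i. (f i (Suc j) $ a - (N i *\<^sub>v f i j) $ a) / (s - lam i) ^ j)"
        by (simp add: diff_divide_distrib sum_subtractf)
    qed
    finally show "(\<Sum>i=1..k. \<Sum>j=1..r i. (f i (Suc j) $ a - (N i *\<^sub>v f i j) $ a) / (s - lam i) ^ j) =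
      (if a = m then 1 else 0) - (\<Sum>i=1..k. f i 1 $ a)"
      by (simp add: sum.distrib)
  qed (use inj i j in simp_all)
  thus "(N i *\<^sub>v col (B (i, j)) m) $ a = (if j < r i then col (B (i, Suc j)) m else 0\<^sub>v n) $ a"
    using j by (auto simp: f_def Suc_le_eq)
qed (use A B_carrier[OF i, of "Suc j"] j in \<open>auto simp: char_matrix_def\<close>)

lemma char_matrix_pow_mult_col:
  assumes i: "i \<in> {1..k}" and j: "j \<in> {1..r i}" and m: "m < n"
  shows "(N i ^\<^sub>m (r i + 1 - j)) *\<^sub>v col (B (i, j)) m = 0\<^sub>v n"
  using j
proof (induction "r i - j" arbitrary: j)
  case 0
  hence "j = r i" by simp
  thus ?case using char_matrix_mult_col[OF i 0(2) m] N_carrier[of i] by simp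
next
  case (Suc d)
  have C: "col (B (i, j)) m \<in> carrier_vec n" using B_carrier[OF i Suc.prems] by auto
  have e: "r i + 1 - j = Suc (r i + 1 - Suc j)" using Suc.prems Suc.hyps(2) by simp
  have "(N i ^\<^sub>m (r i + 1 - j)) *\<^sub>v col (B (i, j)) m =
     (N i ^\<^sub>m (r i + 1 - Suc j)) *\<^sub>v (N i *\<^sub>v col (B (i, j)) m)"
    unfolding e pow_mat.simps by (rule assoc_mult_mat_vec[OF pow_carrier_mat[OF N_carrier] N_carrier C])
  also have "N i *\<^sub>v col (B (i, j)) m = col (B (i, Suc j)) m"
    using char_matrix_mult_col[OF i Suc.prems m] Suc.hyps(2) by (simp split: if_splits)
  finally show ?case using Suc.hyps(1)[of "Suc j"] Suc.hyps(2) by auto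
qed

text \<open>The right-hand sides are the entries of the vector \<open>y\<close> with \<open>(s I - A) y = v\<close>: writing
  \<open>s I - A\<close> as \<open>(s - lam i) I - N i\<close>, the product telescopes to \<open>v - N i ^ p v / (s - lam i) ^ p\<close>.\<close>

lemma resolvent_gen_eigenvector:
  assumes s: "s \<notin> lam ` {1..k}" and i: "i \<in> {1..k}"
    and v: "v \<in> carrier_vec n" and p: "(N i ^\<^sub>m p) *\<^sub>v v = 0\<^sub>v n" and a: "a < n"
  shows "(R s *\<^sub>v v) $ a = (\<Sum>j=1..p. ((N i ^\<^sub>m (j - 1)) *\<^sub>v v) $ a / (s - lam i) ^ j)"
proof -
  define u where "u j = (N i ^\<^sub>m j) *\<^sub>v v" for j
  have u: "u j \<in> carrier_vec n" for j unfolding u_def by (rule mult_mat_vec_carrier[OF pow_carrier_mat[OF N_carrier] v])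
  have u0: "u 0 = v" using N_carrier[of i] v by (simp add: u_def)
  have Nu: "N i *\<^sub>v u j = u (Suc j)" for j
    unfolding u_def by (rule mult_vec_pow_mat[OF N_carrier v])
  have x: "s - lam i \<noteq> 0" using s i by auto
  define y where "y = vec n (\<lambda>a. \<Sum>j=1..p. u (j - 1) $ a / (s - lam i) ^ j)"
  have y: "y \<in> carrier_vec n" by (simp add: y_def)
  let ?M = "s \<cdot>\<^sub>m 1\<^sub>m n - A"
  have M: "?M \<in> carrier_mat n n" using A by (intro minus_carrier_mat)
  have "?M *\<^sub>v y = v"
  proof (rule eq_vecI)
    fix a assume "a < dim_vec v"
    hence a: "a < n" using v by simp
    have "(N i *\<^sub>v y) $ a = (\<Sum>c<n. \<Sum>j=1..p. N i $$ (a, c) * u (j - 1) $ c / (s - lam i) ^ j)"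
      unfolding index_mult_vec_sum[OF N_carrier y a] by (auto simp: y_def sum_distrib_left mult.assoc intro!: sum.cong)
    also have "\<dots> = (\<Sum>j=1..p. \<Sum>c<n. N i $$ (a, c) * u (j - 1) $ c / (s - lam i) ^ j)"
      by (rule sum.swap)
    also have "\<dots> = (\<Sum>j=1..p. (N i *\<^sub>v u (j - 1)) $ a / (s - lam i) ^ j)"
      by (simp add: index_mult_vec_sum[OF N_carrier u a] sum_divide_distrib)
    finally have Ny: "(N i *\<^sub>v y) $ a = (\<Sum>j=1..p. u j $ a / (s - lam i) ^ j)"
      by (simp add: Nu)
    have "(s - lam i) * y $ a = (\<Sum>j=1..p. u (j - 1) $ a / (s - lam i) ^ (j - 1))"
      unfolding y_def index_vec[OF a] sum_distrib_left
    proof (intro sum.cong refl)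
      fix j assume "j \<in> {1..p}"
      then obtain t where "j = Suc t" by (cases j) auto
      thus "(s - lam i) * (u (j - 1) $ a / (s - lam i) ^ j) = u (j - 1) $ a / (s - lam i) ^ (j - 1)"
        using x by simp
    qed
    hence "(?M *\<^sub>v y) $ a = (\<Sum>j=1..p. u (j - 1) $ a / (s - lam i) ^ (j - 1) - u j $ a / (s - lam i) ^ j)"
      unfolding resolvent_mult_index[OF y a, of s i] Ny by (simp add: sum_subtractf)
    also have "\<dots> = (\<Sum>j<p. u j $ a / (s - lam i) ^ j - u (Suc j) $ a / (s - lam i) ^ Suc j)"
      by (rule sum.reindex_bij_witness[of _ Suc "\<lambda>j. j - 1"]) auto
    also have "\<dots> = u 0 $ a / (s - lam i) ^ 0 - u p $ a / (s - lam i) ^ p"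
      by (rule sum_lessThan_telescope')
    also have "\<dots> = v $ a" using p a by (simp add: u0) (simp add: u_def)
    finally show "(?M *\<^sub>v y) $ a = v $ a" .
  qed (use A v in auto)
  hence "R s *\<^sub>v v = (R s * ?M) *\<^sub>v y" using assoc_mult_mat_vec[OF R_carrier M y] by simp
  also have "\<dots> = y" using R_inverse(2)[OF s] y by simp
  finally show ?thesis using a by (simp add: y_def u_def)
qed

text \<open>Both \<open>R s v\<close> and the finite sum of the preceding lemma are expansions in the same partial
  fractions, so their coefficients agree. The second claim is immediate for \<open>p \<le> r i\<close>; otherwise it
  is the comparison at \<open>j = r i + 1\<close>, where the expansion of the resolvent has no term.\<close>

lemma coefficients_mult_gen_eigenvector:
  assumes i: "i \<in> {1..k}"
    and v: "v \<in> carrier_vec n" and p: "(N i ^\<^sub>m p) *\<^sub>v v = 0\<^sub>v n"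
  shows "j \<in> {1..r i} \<Longrightarrow> B (i, j) *\<^sub>v v = (N i ^\<^sub>m (j - 1)) *\<^sub>v v"
    and "(N i ^\<^sub>m r i) *\<^sub>v v = 0\<^sub>v n"
proof -
  define u where "u j = (if j \<le> p then (N i ^\<^sub>m (j - 1)) *\<^sub>v v else 0\<^sub>v n)" for j
  define w where "w l j = (if j \<le> r l then B (l, j) *\<^sub>v v else 0\<^sub>v n)" for l j
  \<comment> \<open>The two expansions have different lengths; both are padded by zeros to the common length \<open>r'\<close>.\<close>
  define r' where "r' l = max (r l) p" for l
  have u: "u j = (N i ^\<^sub>m (j - 1)) *\<^sub>v v" if "1 \<le> j" for j
  proof (cases "j \<le> p")
    case False
    hence "p \<le> j - 1" by simp
    from pow_mat_mult_zero_vec_mono[OF N_carrier v p this] show ?thesis using False by (simp add: u_def)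
  qed (simp add: u_def)
  have eq: "w i j $ a = u j $ a" if j: "j \<in> {1..r' i}" and a: "a < n" for j a
  proof -
    have "w i j $ a - (if i = i then u j $ a else 0) = 0"
    proof (rule partial_fractions_unique[where I = "{1..k}" and lam = lam and r = r' and i = i and j = j
        and c = "\<lambda>l j. w l j $ a - (if l = i then u j $ a else 0)" and d = 0])
      fix s assume s: "s \<notin> lam ` {1..k}"
      have "(R s *\<^sub>v v) $ a = (\<Sum>b<n. R s $$ (a, b) * v $ b)"
        by (rule index_mult_vec_sum[OF R_carrier v a])
      also have "\<dots> = (\<Sum>b<n. \<Sum>l=1..k. \<Sum>j=1..r l. B (l, j) $$ (a, b) * v $ b / (s - lam l) ^ j)"
        using a by (auto simp: index_R sum_distrib_right intro!: sum.cong)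
      also have "\<dots> = (\<Sum>l=1..k. \<Sum>b<n. \<Sum>j=1..r l. B (l, j) $$ (a, b) * v $ b / (s - lam l) ^ j)"
        by (rule sum.swap)
      also have "\<dots> = (\<Sum>l=1..k. \<Sum>j=1..r l. \<Sum>b<n. B (l, j) $$ (a, b) * v $ b / (s - lam l) ^ j)"
        by (intro sum.cong refl sum.swap)
      also have "\<dots> = (\<Sum>l=1..k. \<Sum>j=1..r l. w l j $ a / (s - lam l) ^ j)"
      proof (intro sum.cong refl)
        fix l j assume lj: "l \<in> {1..k}" "j \<in> {1..r l}"
        show "(\<Sum>b<n. B (l, j) $$ (a, b) * v $ b / (s - lam l) ^ j) = w l j $ a / (s - lam l) ^ j"
          using lj by (simp add: w_def index_mult_vec_sum[OF B_carrier[OF lj] v a] sum_divide_distrib)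
      qed
      also have "\<dots> = (\<Sum>l=1..k. \<Sum>j=1..r' l. w l j $ a / (s - lam l) ^ j)"
        using a by (intro sum.cong refl sum.mono_neutral_left) (auto simp: r'_def w_def)
      finally have 1: "(R s *\<^sub>v v) $ a = (\<Sum>l=1..k. \<Sum>j=1..r' l. w l j $ a / (s - lam l) ^ j)" .
      have "(R s *\<^sub>v v) $ a = (\<Sum>j=1..p. u j $ a / (s - lam i) ^ j)"
        unfolding resolvent_gen_eigenvector[OF s i v p a] by (intro sum.cong) (auto simp: u_def)
      also have "\<dots> = (\<Sum>j=1..r' i. u j $ a / (s - lam i) ^ j)"
        using a by (intro sum.mono_neutral_left) (auto simp: r'_def u_def)
      also have "\<dots> = (\<Sum>l=1..k. if l = i then \<Sum>j=1..r' l. u j $ a / (s - lam l) ^ j else 0)"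
        using i by simp
      also have "\<dots> = (\<Sum>l=1..k. \<Sum>j=1..r' l. (if l = i then u j $ a else 0) / (s - lam l) ^ j)"
        by (intro sum.cong refl) auto
      finally show "(\<Sum>l=1..k. \<Sum>j=1..r' l. (w l j $ a - (if l = i then u j $ a else 0)) / (s - lam l) ^ j) = 0"
        using 1 by (simp add: diff_divide_distrib sum_subtractf)
    qed (use inj i j in simp_all)
    thus ?thesis by simp
  qed
  show "B (i, j) *\<^sub>v v = (N i ^\<^sub>m (j - 1)) *\<^sub>v v" if j: "j \<in> {1..r i}"
  proof (rule eq_vecI)
    fix a assume "a < dim_vec ((N i ^\<^sub>m (j - 1)) *\<^sub>v v)"
    hence "a < n" using N_carrier[of i] by (simp add: carrier_matD)
    thus "(B (i, j) *\<^sub>v v) $ a = ((N i ^\<^sub>m (j - 1)) *\<^sub>v v) $ a"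
      using eq[of j a] j u[of j] by (simp add: r'_def w_def le_max_iff_disj)
  qed (use B_carrier[OF i j] N_carrier[of i] in auto)
  show "(N i ^\<^sub>m r i) *\<^sub>v v = 0\<^sub>v n"
  proof (cases "p \<le> r i")
    case True
    thus ?thesis by (rule pow_mat_mult_zero_vec_mono[OF N_carrier v p])
  next
    case False
    show ?thesis
    proof (rule eq_vecI)
      fix a assume "a < dim_vec (0\<^sub>v n :: complex vec)"
      thus "((N i ^\<^sub>m r i) *\<^sub>v v) $ a = 0\<^sub>v n $ a"
        using eq[of "Suc (r i)" a] u[of "Suc (r i)"] False by (simp add: r'_def w_def)
    qed (use N_carrier[of i] in auto)
  qed
qed

section \<open>Generalized eigenvectors in the column spaces\<close>

lemma column_eigenvector:
  assumes i: "i \<in> {1..k}" and b: "b \<in> set (cols (B (i, r i)))" "b \<noteq> 0\<^sub>v n"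
  shows "eigenvector A b (lam i)"
proof -
  have j: "r i \<in> {1..r i}" using r_pos[OF i] by simp
  from b(1) obtain m where m: "m < n" "b = col (B (i, r i)) m"
    using B_carrier[OF i j] by (auto simp: cols_def)
  have "b \<in> carrier_vec n" using B_carrier[OF i j] m by (auto intro: col_carrier_vec)
  thus ?thesis
    using char_matrix_mult_col[OF i j m(1)] b(2) m(2) by (simp add: eigenvector_char_matrix[OF A])
qed

lemma column_gen_eigenvector:
  assumes i: "i \<in> {1..k}" and j: "j \<in> {1..r i}" and b: "b \<in> set (cols (B (i, j)))" "b \<noteq> 0\<^sub>v n"
  shows "generalized_eigenvector A b (lam i)" "gen_eigvec_rank A b (lam i) \<le> r i + 1 - j"
proof -
  from b(1) obtain m where m: "m < n" "b = col (B (i, j)) m"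
    using B_carrier[OF i j] by (auto simp: cols_def)
  have C: "b \<in> carrier_vec n" using B_carrier[OF i j] m by (auto intro: col_carrier_vec)
  have p: "r i + 1 - j \<ge> 1 \<and> (N i ^\<^sub>m (r i + 1 - j)) *\<^sub>v b = 0\<^sub>v (dim_row A)"
    using char_matrix_pow_mult_col[OF i j m(1)] m(2) j A by auto
  thus "generalized_eigenvector A b (lam i)"
    using C b(2) A unfolding generalized_eigenvector_def by auto
  show "gen_eigvec_rank A b (lam i) \<le> r i + 1 - j"
    unfolding gen_eigvec_rank_def by (rule Least_le) (rule p)
qed

lemma columns_chain:
  assumes i: "i \<in> {1..k}" and m: "m < n"
  shows "gen_eigvec_chain A (lam i)
    (filter (\<lambda>v. v \<noteq> 0\<^sub>v n) (map (\<lambda>j. col (B (i, j)) m) [1..<r i + 1]))"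
proof -
  define f where "f j = col (B (i, j)) m" for j
  have f: "f j \<in> carrier_vec n" if "j \<in> {1..r i}" for j
    unfolding f_def using B_carrier[OF i that] m by (auto intro: col_carrier_vec)
  have Nf: "N i *\<^sub>v f j = (if j < r i then f (Suc j) else 0\<^sub>v n)" if "j \<in> {1..r i}" for j
    unfolding f_def by (rule char_matrix_mult_col[OF i that m])
  have N0: "N i *\<^sub>v 0\<^sub>v n = 0\<^sub>v n" using N_carrier[of i] by (intro eq_vecI) auto
  obtain t where t: "t \<le> r i" "filter (\<lambda>v. v \<noteq> 0\<^sub>v n) (map f [1..<r i + 1]) = map f [1..<t + 1]"
    "\<And>j. 1 \<le> j \<Longrightarrow> j \<le> t \<Longrightarrow> f j \<noteq> 0\<^sub>v n" "t < r i \<Longrightarrow> f (Suc t) = 0\<^sub>v n"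
    using filter_nonzero_prefix[of "r i" f "0\<^sub>v n"] Nf N0 by force
  have "gen_eigvec_chain A (lam i) (map f [1..<t + 1])"
    unfolding gen_eigvec_chain_def
  proof (intro conjI ballI allI impI)
    fix v assume "v \<in> set (map f [1..<t + 1])"
    thus "v \<in> carrier_vec (dim_row A)" "v \<noteq> 0\<^sub>v (dim_row A)"
      using f t(1,3) A by auto
  next
    fix j assume "Suc j < length (map f [1..<t + 1])"
    thus "N i *\<^sub>v map f [1..<t + 1] ! j = map f [1..<t + 1] ! Suc j"
      using Nf[of "Suc j"] t(1) by (simp del: upt_Suc)
  next
    assume "map f [1..<t + 1] \<noteq> []"
    hence "t \<ge> 1" by (simp del: upt_Suc)
    thus "N i *\<^sub>v last (map f [1..<t + 1]) = 0\<^sub>v (dim_row A)"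
      using Nf[of t] t(1,4) A by (auto simp: last_map)
  qed
  thus ?thesis unfolding f_def[symmetric] t(2) .
qed

text \<open>If \<open>v = N i ^ m w\<close> is killed by a power of \<open>N i\<close>, then so is \<open>w\<close>. Hence \<open>N i ^ r i w = 0\<close>, which
  rules out \<open>m \<ge> r i\<close>. For \<open>j \<le> m + 1\<close>, the vector \<open>x = N i ^ (m + 1 - j) w\<close> satisfies
  \<open>B (i, j) x = N i ^ (j - 1) x = v\<close>.\<close>

lemma gen_eigenvector_image:
  assumes i: "i \<in> {1..k}" and v: "generalized_eigenvector A v (lam i)"
    and m: "v \<in> mat_image (N i ^\<^sub>m m)"
  shows "m < r i" "\<And>j. j \<in> {1..m + 1} \<Longrightarrow> v \<in> vec_space.col_space n (B (i, j))"
proof -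
  obtain p where p: "(N i ^\<^sub>m p) *\<^sub>v v = 0\<^sub>v n" and vC: "v \<in> carrier_vec n" and v0: "v \<noteq> 0\<^sub>v n"
    using v A unfolding generalized_eigenvector_def by auto
  from m obtain w where w: "w \<in> carrier_vec n" and vw: "v = (N i ^\<^sub>m m) *\<^sub>v w"
    using pow_carrier_mat[OF N_carrier, of i m] unfolding mat_image_def by (auto simp del: pow_mat_dim)
  have pw: "(N i ^\<^sub>m (p + m)) *\<^sub>v w = 0\<^sub>v n"
    using pow_mat_mult_vec_add[OF N_carrier w, of i p m] p vw by simp
  show mr: "m < r i"
  proof (rule ccontr)
    assume "\<not> m < r i"
    hence "(N i ^\<^sub>m m) *\<^sub>v w = 0\<^sub>v n"
      using pow_mat_mult_zero_vec_mono[OF N_carrier w coefficients_mult_gen_eigenvector(2)[OF i w pw]] by simp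
    thus False using v0 vw by simp
  qed
  fix j assume j: "j \<in> {1..m + 1}"
  hence jr: "j \<in> {1..r i}" using mr by auto
  define x where "x = (N i ^\<^sub>m (m + 1 - j)) *\<^sub>v w"
  have x: "x \<in> carrier_vec n" unfolding x_def by (rule mult_mat_vec_carrier[OF pow_carrier_mat[OF N_carrier] w])
  have vx: "v = (N i ^\<^sub>m (j - 1)) *\<^sub>v x"
    using pow_mat_mult_vec_add[OF N_carrier w, of i "j - 1" "m + 1 - j"] j vw by (simp add: x_def)
  have "(N i ^\<^sub>m (p + (j - 1))) *\<^sub>v x = 0\<^sub>v n"
    using pow_mat_mult_vec_add[OF N_carrier x, of i p "j - 1"] p vx by simp
  hence "B (i, j) *\<^sub>v x = v"
    using coefficients_mult_gen_eigenvector(1)[OF i x _ jr] vx by simp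
  thus "v \<in> vec_space.col_space n (B (i, j))"
    using vec_space.col_space_eq[OF B_carrier[OF i jr]] B_carrier[OF i jr] x vC by auto
qed

end

theorem theorem2p1:
  fixes A :: "complex mat" and n k :: nat and lam :: "nat \<Rightarrow> complex" and r :: "nat \<Rightarrow> nat"
  assumes "A \<in> carrier_mat n n"
    and "bij_betw lam {1..k} {e. eigenvalue A e}"
    and "\<And>i. i \<in> {1..k} \<Longrightarrow> r i = Polynomial.order (lam i) (char_poly A)"
  shows "(\<exists>!B. resolvent_pfd n A k lam r B) \<and>
    (\<forall>B. resolvent_pfd n A k lam r B \<longrightarrow>
      (\<forall>i\<in>{1..k}.
        (\<forall>b\<in>set (cols (B (i, r i))). b \<noteq> 0\<^sub>v n \<longrightarrow> eigenvector A b (lam i)) \<and>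
        (\<forall>j\<in>{1..r i}. \<forall>b\<in>set (cols (B (i, j))). b \<noteq> 0\<^sub>v n \<longrightarrow>
            generalized_eigenvector A b (lam i) \<and>
            gen_eigvec_rank A b (lam i) \<le> r i + 1 - j) \<and>
        (\<forall>m<n. gen_eigvec_chain A (lam i)
            (filter (\<lambda>v. v \<noteq> 0\<^sub>v n) (map (\<lambda>j. col (B (i, j)) m) [1..<r i + 1]))) \<and>
        (\<forall>v. generalized_eigenvector A v (lam i) \<longrightarrow>
            (let M = {m. v \<in> mat_image (char_matrix A (lam i) ^\<^sub>m m)};
                 j0 = 1 + Max M
             in finite M \<and> j0 \<le> r i \<and>
                (\<forall>j\<in>{1..j0}. v \<in> vec_space.col_space n (B (i, j)))))))"
proof (intro conjI allI impI ballI)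
  have inj: "inj_on lam {1..k}" using assms(2) by (rule bij_betw_imp_inj_on)
  show "\<exists>!B. resolvent_pfd n A k lam r B"
    using resolvent_pfd_exists[OF assms] resolvent_pfd_unique[OF inj] by blast
  fix B i assume pfd: "resolvent_pfd n A k lam r B" and i: "i \<in> {1..k}"
  interpret resolvent_expansion n k A lam r B
  proof
    fix i assume i: "i \<in> {1..k}"
    have "poly (char_poly A) (lam i) = 0"
      using bij_betwE[OF assms(2)] i eigenvalue_root_char_poly[OF assms(1)] by blast
    moreover have "char_poly A \<noteq> 0" using degree_monic_char_poly[OF assms(1)] by auto
    ultimately show "1 \<le> r i" using assms(3)[OF i] by (simp add: order_root Suc_le_eq)
  qed (use assms inj pfd in auto)
  show "eigenvector A b (lam i)" if "b \<in> set (cols (B (i, r i)))" "b \<noteq> 0\<^sub>v n" for b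
    by (rule column_eigenvector[OF i that])
  show "generalized_eigenvector A b (lam i)" "gen_eigvec_rank A b (lam i) \<le> r i + 1 - j"
    if "j \<in> {1..r i}" "b \<in> set (cols (B (i, j)))" "b \<noteq> 0\<^sub>v n" for j b
    by (rule column_gen_eigenvector[OF i that])+
  show "gen_eigvec_chain A (lam i)
      (filter (\<lambda>v. v \<noteq> 0\<^sub>v n) (map (\<lambda>j. col (B (i, j)) m) [1..<r i + 1]))" if "m < n" for m
    by (rule columns_chain[OF i that])
  fix v assume v: "generalized_eigenvector A v (lam i)"
  define M where "M = {m. v \<in> mat_image (char_matrix A (lam i) ^\<^sub>m m)}"
  have "M \<subseteq> {..<r i}" unfolding M_def using gen_eigenvector_image(1)[OF i v] by auto
  hence fin: "finite M" by (rule finite_subset) simp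
  have "v \<in> carrier_vec n" using v assms(1) by (auto simp: generalized_eigenvector_def)
  \<comment> \<open>The zeroth power is the identity, so \<open>M\<close> is nonempty and its maximum is attained.\<close>
  hence "0 \<in> M" using assms(1) by (auto simp: M_def mat_image_def char_matrix_def intro!: image_eqI[of _ _ v])
  hence "Max M \<in> M" using fin by (intro Max_in) auto
  hence mx: "v \<in> mat_image (char_matrix A (lam i) ^\<^sub>m Max M)" unfolding M_def by simp
  show "let M = {m. v \<in> mat_image (char_matrix A (lam i) ^\<^sub>m m)}; j0 = 1 + Max M
    in finite M \<and> j0 \<le> r i \<and> (\<forall>j\<in>{1..j0}. v \<in> vec_space.col_space n (B (i, j)))"
    unfolding Let_def M_def[symmetric]
    using fin gen_eigenvector_image[OF i v mx] by (auto simp: add.commute)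
qed

end
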